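(* Let $\mathbb{F}$ be an arbitrary field, let $\mathbf{O}=\mathbf{O}(\mathbb{F})$ be the split-octonion algebra over $\mathbb{F}$, and let $c\in\mathbf{O}$. Let $X\subseteq\mathbf{O}$ be the set of all solutions of the equation $x^2=c$, where $x\in\mathbf{O}$ is a variable. 1. Assume $c=\gamma1_{\mathbf{O}}$ for some $\gamma\in\mathbb{F}$. Then $$X=\pm\sqrt{\gamma}\,1_{\mathbf{O}}\;\cup\;O(0,\gamma).$$ 2. Assume $c\notin\mathbb{F}1_{\mathbf{O}}$ and $\mathrm{char}\,\mathbb{F}\neq2$. (a) If $n(c)\in\mathbb{F}^2$, denote $\alpha=\mathrm{tr}(c)+2\sqrt{n(c)}$ and $\beta=\mathrm{tr}(c)-2\sqrt{n(c)}$. - If $\alpha,\beta\in(\mathbb{F}^{\times})^2$, then $$X=\Big\{\pm\frac{1}{\sqrt{\alpha}}\big(c+\sqrt{n(c)}1_{\mathbf{O}}\big),\ \pm\frac{1}{\sqrt{\beta}}\big(c-\sqrt{n(c)}1_{\mathbf{O}}\big)\Big\}.$$ - If $\alpha\in(\mathbb{F}^{\times})^2$ and $\beta\notin(\mathbb{F}^{\times})^2$, then $$X=\Big\{\pm\frac{1}{\sqrt{\alpha}}\big(c+\sqrt{n(c)}1_{\mathbf{O}}\big)\Big\}.$$ - If $\alpha\notin(\mathbb{F}^{\times})^2$ and $\beta\in(\mathbb{F}^{\times})^2$, then $$X=\Big\{\pm\frac{1}{\sqrt{\beta}}\big(c-\sqrt{n(c)}1_{\mathbf{O}}\big)\Big\}.$$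 - If $\alpha,\beta\notin(\mathbb{F}^{\times})^2$, then $X=\emptyset$. (b) If $n(c)\notin\mathbb{F}^2$, then $X=\emptyset$. 3. Assume $c\notin\mathbb{F}1_{\mathbf{O}}$ and $\mathrm{char}\,\mathbb{F}=2$. (a) If $\mathrm{tr}(c)\neq0$, then $$X=\begin{cases}\frac{1}{\sqrt{\mathrm{tr}(c)}}\Big(c+\sqrt{n(c)}1_{\mathbf{O}}\Big),&\text{if }\mathrm{tr}(c),n(c)\in\mathbb{F}^2,\\ \emptyset,&\text{otherwise.}\end{cases}$$ (b) If $\mathrm{tr}(c)=0$, then $X=\emptyset$.
   Context: $\mathbb{F}$ is a field (possibly finite) of arbitrary characteristic. The split-octonion algebra $\mathbf{O}=\mathbf{O}(\mathbb{F})$ is the $8$-dimensional vector space of all matrices $a=\begin{pmatrix}\alpha&\mathbf{u}\\ \mathbf{v}&\beta\end{pmatrix}$ with $\alpha,\beta\in\mathbb{F}$ and vectors $\mathbf{u},\mathbf{v}\in\mathbb{F}^3$ (the space of triples), with multiplication $$aa'=\begin{pmatrix}\alpha\alpha'+\mathbf{u}\cdot\mathbf{v}'&\alpha\mathbf{u}'+\beta'\mathbf{u}-\mathbf{v}\times\mathbf{v}'\\ \alpha'\mathbf{v}+\beta\mathbf{v}'+\mathbf{u}\times\mathbf{u}'&\beta\beta'+\mathbf{v}\cdot\mathbf{u}'\end{pmatrix},\qquad a'=\begin{pmatrix}\alpha'&\mathbf{u}'\\ \mathbf{v}'&\beta'\end{pmatrix},$$ where $\cdot$ and $\times$ are the usual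 dot and cross products on $\mathbb{F}^3$. The unity $1_{\mathbf{O}}$ is the element with $\alpha=\beta=1$, $\mathbf{u}=\mathbf{v}=\mathbf{0}$. The trace is $\mathrm{tr}(a)=\alpha+\beta$ and the norm is $n(a)=\alpha\beta-\mathbf{u}\cdot\mathbf{v}$. $\mathrm{Aut}(\mathbf{O})$ is the group of all automorphisms of the algebra $\mathbf{O}$. For $\lambda,\mu\in\mathbb{F}$, $O(\lambda,\mu)$ denotes the $\mathrm{Aut}(\mathbf{O})$-orbit of $\begin{pmatrix}\lambda&(\mu,0,0)\\(1,0,0)&0\end{pmatrix}$. When speaking of squares, $\mathbb{F}^2$ denotes the set $\{\alpha^2\mid\alpha\in\mathbb{F}\}$; $\mathbb{F}^{\times}=\mathbb{F}\setminus\{0\}$, and $(\mathbb{F}^{\times})^2$ is the set of squares of non-zero elements of $\mathbb{F}$. For each $\beta\in\mathbb{F}^2$ an element $\sqrt{\beta}\in\mathbb{F}$ with $(\sqrt{\beta})^2=\beta$ is fixed; the set of all solutions $\nu\in\mathbb{F}$ of $\nu^2=\beta$ is then $\{\pm\sqrt{\beta}\}$. *)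

theory Defs
  imports "HOL-Analysis.Cartesian_Space"
begin

text \<open>The library's dot and cross products are restricted to real vectors; these are the same
  coordinate formulas over an arbitrary field.\<close>

definition dot3 :: "'a::field ^ 3 \<Rightarrow> 'a ^ 3 \<Rightarrow> 'a"
  where "dot3 u v = (\<Sum>i\<in>UNIV. u $ i * v $ i)"

definition crossp3 :: "'a::field ^ 3 \<Rightarrow> 'a ^ 3 \<Rightarrow> 'a ^ 3"
  where "crossp3 u v = vector [u$2 * v$3 - u$3 * v$2,
                               u$3 * v$1 - u$1 * v$3,
                               u$1 * v$2 - u$2 * v$1]"

text \<open>\<open>Oct \<alpha> u v \<beta>\<close> is the matrix with first row \<open>\<alpha>, u\<close> and second row \<open>v, \<beta>\<close>.\<close>

datatype 'a octonion = Oct (oct_a: 'a) (oct_u: "'a ^ 3") (oct_v: "'a ^ 3") (oct_b: 'a)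

instantiation octonion :: (field) ab_group_add
begin

definition zero_octonion :: "'a octonion"
  where "0 = Oct 0 0 0 0"

definition plus_octonion :: "'a octonion \<Rightarrow> 'a octonion \<Rightarrow> 'a octonion"
  where "x + y = Oct (oct_a x + oct_a y) (oct_u x + oct_u y) (oct_v x + oct_v y) (oct_b x + oct_b y)"

definition minus_octonion :: "'a octonion \<Rightarrow> 'a octonion \<Rightarrow> 'a octonion"
  where "x - y = Oct (oct_a x - oct_a y) (oct_u x - oct_u y) (oct_v x - oct_v y) (oct_b x - oct_b y)"

definition uminus_octonion :: "'a octonion \<Rightarrow> 'a octonion"
  where "- x = Oct (- oct_a x) (- oct_u x) (- oct_v x) (- oct_b x)"

instance
  by standard
    (auto simp: zero_octonion_def plus_octonion_def minus_octonion_def uminus_octonion_def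
      intro: octonion.expand)

end

instantiation octonion :: (field) "{one, times}"
begin

definition one_octonion :: "'a octonion"
  where "1 = Oct 1 0 0 1"

definition times_octonion :: "'a octonion \<Rightarrow> 'a octonion \<Rightarrow> 'a octonion"
  where "x * y =
    Oct (oct_a x * oct_a y + dot3 (oct_u x) (oct_v y))
        (oct_a x *s oct_u y + oct_b y *s oct_u x - crossp3 (oct_v x) (oct_v y))
        (oct_a y *s oct_v x + oct_b x *s oct_v y + crossp3 (oct_u x) (oct_u y))
        (oct_b x * oct_b y + dot3 (oct_v x) (oct_u y))"

instance ..

end

definition oct_scale :: "'a::field \<Rightarrow> 'a octonion \<Rightarrow> 'a octonion"  (infixr \<open>*\<^sub>O\<close> 75)
  where "k *\<^sub>O x = Oct (k * oct_a x) (k *s oct_u x) (k *s oct_v x) (k * oct_b x)"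

lemma vector_space_octonion: "vector_space (oct_scale :: 'a::field \<Rightarrow> _)"
  by standard
    (auto simp: oct_scale_def plus_octonion_def algebra_simps vec_eq_iff intro: octonion.expand)

definition oct_tr :: "'a::field octonion \<Rightarrow> 'a"
  where "oct_tr x = oct_a x + oct_b x"

definition oct_norm :: "'a::field octonion \<Rightarrow> 'a"
  where "oct_norm x = oct_a x * oct_b x - dot3 (oct_u x) (oct_v x)"

definition oct_scalars :: "'a::field octonion set"
  where "oct_scalars = range (\<lambda>\<gamma>. \<gamma> *\<^sub>O 1)"

definition oct_aut :: "('a::field octonion \<Rightarrow> 'a octonion) set"
  where "oct_aut = {f. Vector_Spaces.linear oct_scale oct_scale f \<and> bij f \<and>
                       (\<forall>x y. f (x * y) = f x * f y)}"

definition oct_orbit :: "'a::field \<Rightarrow> 'a \<Rightarrow> 'a octonion set"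
  where "oct_orbit l m = {f (Oct l (vector [m, 0, 0]) (vector [1, 0, 0]) 0) | f. f \<in> oct_aut}"

definition squares :: "'a::field set"
  where "squares = {\<alpha>\<^sup>2 | \<alpha>. True}"

definition nonzero_squares :: "'a::field set"
  where "nonzero_squares = {\<alpha>\<^sup>2 | \<alpha>. \<alpha> \<noteq> 0}"

text \<open>A choice of square roots: \<open>s \<beta>\<close> is constrained only for \<open>\<beta>\<close> a square.\<close>

definition sqrt_choice :: "('a::field \<Rightarrow> 'a) \<Rightarrow> bool"
  where "sqrt_choice s \<longleftrightarrow> (\<forall>\<beta>\<in>squares. (s \<beta>)\<^sup>2 = \<beta>)"

text \<open>The set \<open>\<plusminus>\<surd>\<beta>\<close> of all solutions of \<open>\<nu>\<^sup>2 = \<beta>\<close>; it is empty if \<open>\<beta>\<close> is not a square.\<close>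

definition pm_sqrt :: "('a::field \<Rightarrow> 'a) \<Rightarrow> 'a \<Rightarrow> 'a set"
  where "pm_sqrt s \<beta> = (if \<beta> \<in> squares then {s \<beta>, - s \<beta>} else {})"

end

theory Submission
  imports Defs
begin

text \<open>Every octonion satisfies \<open>x\<^sup>2 = tr(x) x - n(x)\<close>. If \<open>x\<^sup>2 = c\<close> is not a scalar, then
  \<open>\<tau> = tr(x)\<close> is nonzero and \<open>x = (c + \<nu>) / \<tau>\<close> with \<open>\<nu> = n(x)\<close>; comparing norms and traces gives
  \<open>\<nu>\<^sup>2 = n(c)\<close> and \<open>\<tau>\<^sup>2 = tr(c) + 2\<nu>\<close>, and these conditions are also sufficient.
  If \<open>c = \<gamma>\<close> is a scalar, a nonscalar solution \<open>x\<close> has trace \<open>0\<close> and norm \<open>-\<gamma>\<close>. Such an \<open>x\<close> is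
  moved to the representative of \<open>O(0, \<gamma>)\<close> by automorphisms of three kinds: the swap of the two
  copies of \<open>F\<^sup>3\<close>, unipotent ones which clear the diagonal, and the action of \<open>SL\<^sub>3\<close>.\<close>

section \<open>Trace, norm and the quadratic equation of an octonion\<close>

lemmas oct_ops = zero_octonion_def plus_octonion_def minus_octonion_def uminus_octonion_def
  one_octonion_def times_octonion_def oct_scale_def

lemmas vec3_coords = vec_eq_iff forall_3 sum_3 dot3_def crossp3_def

lemma oct_square: "x * x = oct_tr x *\<^sub>O x - oct_norm x *\<^sub>O 1"
  by (cases x) (simp add: oct_ops oct_tr_def oct_norm_def vec3_coords algebra_simps)

lemma oct_tr_square: "oct_tr (x * x) = (oct_tr x)\<^sup>2 - 2 * oct_norm x"
  by (cases x) (simp add: oct_ops oct_tr_def oct_norm_def vec3_coords algebra_simps power2_eq_square)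

lemma oct_norm_square: "oct_norm (x * x) = (oct_norm x)\<^sup>2"
  by (cases x) (simp add: oct_ops oct_tr_def oct_norm_def vec3_coords algebra_simps power2_eq_square)

text \<open>Expand \<open>(c + \<nu>)\<^sup>2\<close> and replace \<open>c * c\<close> by the
  quadratic equation of \<open>c\<close>. The scalar term vanishes when
  \<open>\<nu>\<^sup>2 = oct_norm c\<close>, which is how it is used.\<close>

lemma scaled_shift_square:
  "(k *\<^sub>O (c + \<nu> *\<^sub>O 1)) * (k *\<^sub>O (c + \<nu> *\<^sub>O 1)) =
    k\<^sup>2 *\<^sub>O ((oct_tr c + 2 * \<nu>) *\<^sub>O c + (\<nu>\<^sup>2 - oct_norm c) *\<^sub>O 1)"
  by (cases c) (simp add: oct_ops oct_tr_def oct_norm_def vec3_coords algebra_simps power2_eq_square)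

lemma oct_scale_one_square: "(\<nu> *\<^sub>O 1) * (\<nu> *\<^sub>O 1) = (\<nu>\<^sup>2) *\<^sub>O (1 :: 'a::field octonion)"
  by (simp add: oct_ops vec3_coords power2_eq_square)

lemma oct_scale_one_inject: "(\<mu> *\<^sub>O 1 = \<nu> *\<^sub>O (1 :: 'a::field octonion)) \<longleftrightarrow> \<mu> = \<nu>"
  by (simp add: oct_ops)

lemma oct_scale_scale: "k *\<^sub>O l *\<^sub>O x = (k * l) *\<^sub>O x"
  by (simp add: oct_ops)

lemma oct_scale_one_left: "1 *\<^sub>O x = x"
  by (cases x) (simp add: oct_ops)

lemma oct_scale_zero_left: "0 *\<^sub>O x = 0"
  by (simp add: oct_ops)

lemma oct_scale_add_left: "(k + l) *\<^sub>O x = k *\<^sub>O x + l *\<^sub>O x"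
  by (simp add: oct_ops vec3_coords algebra_simps)

lemma oct_scale_minus_left: "(- k) *\<^sub>O x = - (k *\<^sub>O x)"
  by (simp add: oct_ops)

section \<open>Square roots of a nonscalar octonion\<close>

lemma oct_square_root_iff:
  assumes c: "c \<notin> oct_scalars"
  shows "x * x = c \<longleftrightarrow>
    (\<exists>\<nu> \<tau>. \<nu>\<^sup>2 = oct_norm c \<and> \<tau>\<^sup>2 = oct_tr c + 2 * \<nu> \<and> \<tau> \<noteq> 0 \<and> x = (1 / \<tau>) *\<^sub>O (c + \<nu> *\<^sub>O 1))"
proof
  assume x: "x * x = c"
  have eq: "oct_tr x *\<^sub>O x = c + oct_norm x *\<^sub>O 1"
    using oct_square[of x] x by (simp add: algebra_simps)
  have tr: "oct_tr x \<noteq> 0"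
  proof
    assume "oct_tr x = 0"
    then have "c = (- oct_norm x) *\<^sub>O 1"
      using eq by (simp add: oct_scale_zero_left oct_scale_minus_left eq_neg_iff_add_eq_0)
    with c show False by (auto simp: oct_scalars_def)
  qed
  then have "x = (1 / oct_tr x) *\<^sub>O (c + oct_norm x *\<^sub>O 1)"
    by (simp add: eq[symmetric] oct_scale_scale oct_scale_one_left)
  then show "\<exists>\<nu> \<tau>. \<nu>\<^sup>2 = oct_norm c \<and> \<tau>\<^sup>2 = oct_tr c + 2 * \<nu> \<and> \<tau> \<noteq> 0 \<and>
      x = (1 / \<tau>) *\<^sub>O (c + \<nu> *\<^sub>O 1)"
    using oct_tr_square[of x] oct_norm_square[of x] x tr
    by (intro exI[of _ "oct_norm x"] exI[of _ "oct_tr x"]) simp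
next
  assume "\<exists>\<nu> \<tau>. \<nu>\<^sup>2 = oct_norm c \<and> \<tau>\<^sup>2 = oct_tr c + 2 * \<nu> \<and> \<tau> \<noteq> 0 \<and>
    x = (1 / \<tau>) *\<^sub>O (c + \<nu> *\<^sub>O 1)"
  then obtain \<nu> \<tau> where "\<nu>\<^sup>2 = oct_norm c" and \<tau>: "\<tau>\<^sup>2 = oct_tr c + 2 * \<nu>" "\<tau> \<noteq> 0"
    and "x = (1 / \<tau>) *\<^sub>O (c + \<nu> *\<^sub>O 1)"
    by blast
  then have "x * x = (1 / \<tau>)\<^sup>2 *\<^sub>O \<tau>\<^sup>2 *\<^sub>O c"
    by (simp add: scaled_shift_square oct_scale_zero_left)
  then show "x * x = c"
    using \<tau>(2) by (simp add: oct_scale_scale oct_scale_one_left power_one_over)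
qed

lemma pm_sqrt_eq:
  assumes "sqrt_choice s"
  shows "{\<nu>. \<nu>\<^sup>2 = \<beta>} = pm_sqrt s \<beta>"
  using assms by (force simp: pm_sqrt_def sqrt_choice_def squares_def power2_eq_iff)

text \<open>A root of \<alpha> is nonzero exactly when \<alpha> is, so the condition
  \<open>\<tau> \<noteq> 0\<close> turns into membership of \<alpha> in
  \<open>nonzero_squares\<close>.\<close>

lemma nonzero_pm_sqrt_eq:
  assumes s: "sqrt_choice s"
  shows "{\<tau>. \<tau>\<^sup>2 = \<alpha> \<and> \<tau> \<noteq> 0} = (if \<alpha> \<in> nonzero_squares then {s \<alpha>, - s \<alpha>} else {})"
proof (cases "\<alpha> \<in> nonzero_squares")
  case True
  then have "\<alpha> \<in> squares" "\<alpha> \<noteq> 0"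
    by (auto simp: nonzero_squares_def squares_def)
  then have "{\<tau>. \<tau>\<^sup>2 = \<alpha> \<and> \<tau> \<noteq> 0} = {\<tau>. \<tau>\<^sup>2 = \<alpha>}"
    by auto
  then show ?thesis
    using True \<open>\<alpha> \<in> squares\<close> by (simp add: pm_sqrt_eq[OF s] pm_sqrt_def)
next
  case False
  then show ?thesis by (auto simp: nonzero_squares_def)
qed

text \<open>\<open>R \<nu>\<close> collects the solutions of norm \<nu>; the two signs of the trace
  \<tau> give \<open>p\<close> and \<open>- p\<close>. Both nonscalar cases of the theorem are read
  off from this union.\<close>

lemma oct_square_roots_nonscalar:
  assumes s: "sqrt_choice s" and c: "c \<notin> oct_scalars"
  defines "R \<equiv> \<lambda>\<nu>. let \<alpha> = oct_tr c + 2 * \<nu>; p = (1 / s \<alpha>) *\<^sub>O (c + \<nu> *\<^sub>O 1)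
    in if \<alpha> \<in> nonzero_squares then {p, - p} else {}"
  shows "{x. x * x = c} = (\<Union>\<nu>\<in>pm_sqrt s (oct_norm c). R \<nu>)"
proof -
  have R: "R \<nu> = (\<lambda>\<tau>. (1 / \<tau>) *\<^sub>O (c + \<nu> *\<^sub>O 1)) ` {\<tau>. \<tau>\<^sup>2 = oct_tr c + 2 * \<nu> \<and> \<tau> \<noteq> 0}" for \<nu>
    by (simp add: nonzero_pm_sqrt_eq[OF s] R_def Let_def oct_scale_minus_left)
  show ?thesis
    unfolding pm_sqrt_eq[OF s, symmetric] R oct_square_root_iff[OF c] by blast
qed

section \<open>Automorphisms and orbits\<close>

lemma oct_linearI:
  assumes "\<And>x y. f (x + y) = f x + f y" and "\<And>k x. f (k *\<^sub>O x) = k *\<^sub>O f x"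
  shows "Vector_Spaces.linear oct_scale oct_scale (f :: 'a::field octonion \<Rightarrow> 'a octonion)"
  using assms by (simp add: Vector_Spaces.linear_iff vector_space_octonion)

lemma oct_autI:
  assumes "\<And>x y. f (x + y) = f x + f y" and "\<And>k x. f (k *\<^sub>O x) = k *\<^sub>O f x"
    and "\<And>x y. f (x * y) = f x * f y" and "\<And>x. g (f x) = x" and "\<And>x. f (g x) = x"
  shows "f \<in> oct_aut"
  using assms oct_linearI[of f] by (auto simp: oct_aut_def intro!: o_bij[of g])

lemma oct_aut_simps:
  assumes "f \<in> oct_aut"
  shows "f (x + y) = f x + f y" "f (k *\<^sub>O x) = k *\<^sub>O f x" "f (x * y) = f x * f y" "bij f"
  using assms by (auto simp: oct_aut_def Vector_Spaces.linear_iff)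

lemma oct_aut_inv_comp:
  assumes f: "f \<in> oct_aut" and g: "g \<in> oct_aut"
  shows "inv f \<circ> g \<in> oct_aut"
proof (rule oct_autI)
  have bij: "bij f" "bij g"
    using f g by (simp_all add: oct_aut_simps)
  show "(inv f \<circ> g) ((inv g \<circ> f) x) = x" "(inv g \<circ> f) ((inv f \<circ> g) x) = x" for x
    using bij by (simp_all add: bij_is_inj bij_is_surj surj_f_inv_f)
  have [simp]: "inv f (f x) = x" "f (inv f x) = x" for x
    using bij by (simp_all add: bij_is_inj bij_is_surj surj_f_inv_f)
  \<comment> \<open>Comparing values after applying \<open>f\<close> reduces each law for
    \<open>inv f\<close> to the same law for \<open>f\<close>.\<close>
  have inv_eq: "f y = x \<Longrightarrow> inv f x = y" for x y
    by auto
  show "(inv f \<circ> g) (x + y) = (inv f \<circ> g) x + (inv f \<circ> g) y"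
    "(inv f \<circ> g) (k *\<^sub>O x) = k *\<^sub>O (inv f \<circ> g) x"
    "(inv f \<circ> g) (x * y) = (inv f \<circ> g) x * (inv f \<circ> g) y" for x y k
    by (auto intro!: inv_eq simp: oct_aut_simps[OF f] oct_aut_simps[OF g])
qed

lemma oct_mult_one_left: "1 * x = (x :: 'a::field octonion)"
  by (cases x) (simp add: oct_ops vec3_coords)

lemma oct_mult_one_right: "x * 1 = (x :: 'a::field octonion)"
  by (cases x) (simp add: oct_ops vec3_coords)

text \<open>Surjectivity is the reason: if \<open>f e = 1\<close>, then
  \<open>f 1 = f e * f 1 = f (e * 1) = f e = 1\<close>.\<close>

lemma oct_aut_one:
  assumes f: "f \<in> oct_aut"
  shows "f 1 = 1"
proof -
  obtain e where e: "f e = 1"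
    using oct_aut_simps(4)[OF f] by (metis bij_pointE)
  have "f 1 = f e * f 1" by (simp add: e oct_mult_one_left)
  also have "\<dots> = f (e * 1)" by (simp only: oct_aut_simps(3)[OF f])
  finally show ?thesis by (simp add: oct_mult_one_right e)
qed

text \<open>This allows an octonion to be normalised by any convenient automorphism before its orbit
  is determined.\<close>

lemma oct_orbit_pullback:
  assumes f: "f \<in> oct_aut" and x: "f x \<in> oct_orbit l m"
  shows "x \<in> oct_orbit l m"
proof -
  obtain g where g: "g \<in> oct_aut" "f x = g (Oct l (vector [m, 0, 0]) (vector [1, 0, 0]) 0)"
    using x by (auto simp: oct_orbit_def)
  have "x = (inv f \<circ> g) (Oct l (vector [m, 0, 0]) (vector [1, 0, 0]) 0)"
    using oct_aut_simps(4)[OF f] by (simp flip: g(2) add: bij_is_inj)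
  then show ?thesis
    using oct_aut_inv_comp[OF f g(1)] unfolding oct_orbit_def by blast
qed

section \<open>The three kinds of automorphisms\<close>

text \<open>The signs compensate for the opposite signs of the two cross products in the
  multiplication.\<close>

definition oct_swap :: "'a::field octonion \<Rightarrow> 'a octonion"
  where "oct_swap x = Oct (oct_b x) (- oct_v x) (- oct_u x) (oct_a x)"

lemma oct_swap_aut: "oct_swap \<in> oct_aut"
proof (rule oct_autI[where g = oct_swap])
  show "oct_swap (x * y) = oct_swap x * oct_swap y" for x y :: "'a octonion"
    by (simp add: oct_ops oct_swap_def vec3_coords algebra_simps)
qed (simp_all add: oct_ops oct_swap_def vec3_coords algebra_simps)

text \<open>Formally this is the exponential 1 + D + D^2/2 of the map D sending
  \<open>Oct a u v b\<close> to
  \<open>Oct (- dot3 w v) ((a - b) *s w) (- crossp3 u w) (dot3 w v)\<close>, for which D^3 = 0. The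
  halving is already carried out, so the formula makes sense in every characteristic.\<close>

definition oct_transvection :: "'a::field ^ 3 \<Rightarrow> 'a octonion \<Rightarrow> 'a octonion"
  where "oct_transvection w x =
    Oct (oct_a x - dot3 w (oct_v x))
        (oct_u x + (oct_a x - oct_b x - dot3 w (oct_v x)) *s w)
        (oct_v x - crossp3 (oct_u x) w)
        (oct_b x + dot3 w (oct_v x))"

lemma oct_transvection_inverse: "oct_transvection (- w) (oct_transvection w x) = x"
  by (cases x) (simp add: oct_transvection_def vec3_coords algebra_simps)

lemma oct_transvection_aut: "oct_transvection w \<in> oct_aut"
proof (rule oct_autI[where g = "oct_transvection (- w)"])
  show "oct_transvection w (x * y) = oct_transvection w x * oct_transvection w y" for x y
    by (simp add: oct_ops oct_transvection_def vec3_coords algebra_simps)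
  show "oct_transvection w (oct_transvection (- w) x) = x" for x
    using oct_transvection_inverse[of "- w"] by simp
qed (simp_all add: oct_transvection_inverse,
    simp_all add: oct_ops oct_transvection_def vec3_coords algebra_simps)


text \<open>This applies the matrix M with columns \<open>a\<close>, \<open>b\<close>,
  \<open>c\<close>. Keeping the columns as vectors expresses cofactors by cross products and det M
  as \<open>dot3 a (crossp3 b c)\<close>.\<close>

definition lincomb3 :: "'a::field ^ 3 \<Rightarrow> 'a ^ 3 \<Rightarrow> 'a ^ 3 \<Rightarrow> 'a ^ 3 \<Rightarrow> 'a ^ 3"
  where "lincomb3 a b c u = u $ 1 *s a + u $ 2 *s b + u $ 3 *s c"

text \<open>For \<open>a, b, c\<close> of determinant one, this is the inverse transpose of \<open>lincomb3 a b c\<close>.\<close>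

definition cofactor3 :: "'a::field ^ 3 \<Rightarrow> 'a ^ 3 \<Rightarrow> 'a ^ 3 \<Rightarrow> 'a ^ 3 \<Rightarrow> 'a ^ 3"
  where "cofactor3 a b c = lincomb3 (crossp3 b c) (crossp3 c a) (crossp3 a b)"

lemma lincomb3_linear:
  "lincomb3 a b c (u + v) = lincomb3 a b c u + lincomb3 a b c v"
  "lincomb3 a b c (u - v) = lincomb3 a b c u - lincomb3 a b c v"
  "lincomb3 a b c (k *s u) = k *s lincomb3 a b c u"
  by (simp_all add: lincomb3_def vec3_coords algebra_simps)

lemma crossp3_lincomb3:
  "crossp3 (lincomb3 a b c u) (lincomb3 a b c v) = cofactor3 a b c (crossp3 u v)"
  by (simp add: lincomb3_def cofactor3_def vec3_coords algebra_simps)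

text \<open>The cofactor matrix of the cofactor matrix of M is det(M) M.\<close>

lemma crossp3_cofactor3:
  "crossp3 (cofactor3 a b c u) (cofactor3 a b c v) =
    dot3 a (crossp3 b c) *s lincomb3 a b c (crossp3 u v)"
  by (simp add: lincomb3_def cofactor3_def vec3_coords algebra_simps)

lemma dot3_lincomb3_cofactor3:
  "dot3 (lincomb3 a b c u) (cofactor3 a b c v) = dot3 a (crossp3 b c) * dot3 u v"
  by (simp add: lincomb3_def cofactor3_def vec3_coords algebra_simps)

lemma dot3_commute: "dot3 u v = dot3 v u"
  by (simp add: dot3_def mult.commute)

text \<open>These are the adjugate identities M adj(M) = adj(M) M = det(M) I and their transposes;
  the rows of adj(M) are the three cross products.\<close>

lemma lincomb3_inverse:
  fixes a b c u :: "'a::field ^ 3"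
  defines "d \<equiv> dot3 a (crossp3 b c)"
  shows "lincomb3 a b c (vector [dot3 (crossp3 b c) u, dot3 (crossp3 c a) u, dot3 (crossp3 a b) u])
      = d *s u"
    "vector [dot3 (crossp3 b c) (lincomb3 a b c u), dot3 (crossp3 c a) (lincomb3 a b c u),
      dot3 (crossp3 a b) (lincomb3 a b c u)] = d *s u"
    "cofactor3 a b c (vector [dot3 a u, dot3 b u, dot3 c u]) = d *s u"
    "vector [dot3 a (cofactor3 a b c u), dot3 b (cofactor3 a b c u), dot3 c (cofactor3 a b c u)]
      = d *s u"
  by (simp_all add: d_def lincomb3_def cofactor3_def vec3_coords algebra_simps)

definition oct_basis_change :: "'a::field ^ 3 \<Rightarrow> 'a ^ 3 \<Rightarrow> 'a ^ 3 \<Rightarrow> 'a octonion \<Rightarrow> 'a octonion"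
  where "oct_basis_change a b c x =
    Oct (oct_a x) (lincomb3 a b c (oct_u x)) (cofactor3 a b c (oct_v x)) (oct_b x)"

text \<open>The inverse transpose in the lower slot preserves dot products, and cross products of
  one slot land correctly in the other; determinant one removes the factors in
  \<open>crossp3_cofactor3\<close> and \<open>dot3_lincomb3_cofactor3\<close>.\<close>

lemma oct_basis_change_aut:
  assumes det: "dot3 a (crossp3 b c) = 1"
  shows "oct_basis_change a b c \<in> oct_aut"
proof (rule oct_autI)
  \<comment> \<open>The inverse applies adj(M) to the upper slot and the transpose of M to the lower
    one.\<close>
  let ?g = "\<lambda>x. Oct (oct_a x)
    (vector [dot3 (crossp3 b c) (oct_u x), dot3 (crossp3 c a) (oct_u x), dot3 (crossp3 a b) (oct_u x)])
    (vector [dot3 a (oct_v x), dot3 b (oct_v x), dot3 c (oct_v x)]) (oct_b x)"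
  show "?g (oct_basis_change a b c x) = x" "oct_basis_change a b c (?g x) = x" for x
    by (simp_all add: oct_basis_change_def lincomb3_inverse det)
  have cof: "cofactor3 a b c (u + v) = cofactor3 a b c u + cofactor3 a b c v"
    "cofactor3 a b c (k *s u) = k *s cofactor3 a b c u" for u v k
    by (simp_all add: cofactor3_def lincomb3_linear)
  have dot: "dot3 (cofactor3 a b c u) (lincomb3 a b c v) = dot3 u v" for u v
    using dot3_lincomb3_cofactor3[of a b c v u] det by (simp add: dot3_commute)
  show "oct_basis_change a b c (x + y) = oct_basis_change a b c x + oct_basis_change a b c y"
    "oct_basis_change a b c (k *\<^sub>O x) = k *\<^sub>O oct_basis_change a b c x"
    "oct_basis_change a b c (x * y) = oct_basis_change a b c x * oct_basis_change a b c y" for x y k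
    by (simp_all add: oct_basis_change_def oct_ops lincomb3_linear cof crossp3_lincomb3
        crossp3_cofactor3 dot3_lincomb3_cofactor3 dot det)
qed

section \<open>Solving dot and cross product equations\<close>

text \<open>The usual solution, \<open>crossp3 v u\<close> divided by \<open>dot3 u u\<close>, fails
  for isotropic \<open>u\<close>, so the witnesses divide by a nonzero coordinate of
  \<open>u\<close> instead.\<close>

lemma exists_crossp3_eq:
  assumes "u \<noteq> 0" "dot3 u v = 0"
  shows "\<exists>w. crossp3 u w = v"
proof -
  have perp: "u $ 1 * v $ 1 = - (u $ 2 * v $ 2) - u $ 3 * v $ 3"
    "u $ 2 * v $ 2 = - (u $ 1 * v $ 1) - u $ 3 * v $ 3"
    "u $ 3 * v $ 3 = - (u $ 1 * v $ 1) - u $ 2 * v $ 2"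
    using assms(2) by (simp_all add: vec3_coords algebra_simps eq_neg_iff_add_eq_0)
  consider "u $ 1 \<noteq> 0" | "u $ 2 \<noteq> 0" | "u $ 3 \<noteq> 0"
    using assms(1) by (auto simp: vec3_coords)
  then show ?thesis
  proof cases
    case 1
    then have "crossp3 u (vector [0, v $ 3 / u $ 1, - v $ 2 / u $ 1]) = v"
      by (simp add: vec3_coords field_simps perp(1))
    then show ?thesis ..
  next
    case 2
    then have "crossp3 u (vector [- v $ 3 / u $ 2, 0, v $ 1 / u $ 2]) = v"
      by (simp add: vec3_coords field_simps perp(2))
    then show ?thesis ..
  next
    case 3
    then have "crossp3 u (vector [v $ 2 / u $ 3, - v $ 1 / u $ 3, 0]) = v"
      by (simp add: vec3_coords field_simps perp(3))
    then show ?thesis ..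
  qed
qed

lemma exists_dot3_eq:
  assumes "v \<noteq> 0"
  shows "\<exists>w. dot3 w v = k"
proof -
  obtain i where i: "v $ i \<noteq> 0"
    using assms by (auto simp: vec_eq_iff)
  have "dot3 (axis i (k / v $ i)) v = (\<Sum>j\<in>UNIV. if j = i then k else 0)"
    unfolding dot3_def using i by (intro sum.cong) (auto simp: axis_def)
  then show ?thesis by auto
qed

lemma exists_dot3_orthogonal: "\<exists>w. w \<noteq> 0 \<and> dot3 w v = 0"
proof (cases "v $ 1 = 0")
  case True
  then show ?thesis
    by (intro exI[of _ "vector [1, 0, 0]"]) (simp add: vec3_coords)
next
  case False
  then show ?thesis
    by (intro exI[of _ "vector [- v $ 2, v $ 1, 0]"]) (simp add: vec3_coords)
qed

section \<open>Traceless nonscalar octonions lie in one orbit for each norm\<close>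

text \<open>A basis change works if \<open>\<gamma> *s a = u\<close>, \<open>crossp3 b c = v\<close>
  and \<open>dot3 a v = 1\<close>, the last being the determinant condition. For
  \<open>\<gamma> = 0\<close> the first equation forces \<open>u = 0\<close>, hence the third
  assumption.\<close>

lemma offdiagonal_in_orbit_basic:
  assumes v: "v \<noteq> 0" and uv: "dot3 u v = \<gamma>" and "\<gamma> \<noteq> 0 \<or> u = 0"
  shows "Oct 0 u v 0 \<in> oct_orbit 0 \<gamma>"
proof -
  have "\<exists>a. dot3 a v = 1 \<and> \<gamma> *s a = u"
  proof (cases "\<gamma> = 0")
    case True
    then show ?thesis using assms exists_dot3_eq[OF v, of 1] by auto
  next
    case False
    then show ?thesis
      using uv by (intro exI[of _ "(1 / \<gamma>) *s u"]) (auto simp: vec3_coords field_simps)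
  qed
  then obtain a where a: "dot3 a v = 1" "\<gamma> *s a = u" by blast
  obtain b where "b \<noteq> 0" "dot3 b v = 0"
    using exists_dot3_orthogonal by blast
  then obtain c where c: "crossp3 b c = v"
    using exists_crossp3_eq by blast
  have "oct_basis_change a b c (Oct 0 (vector [\<gamma>, 0, 0]) (vector [1, 0, 0]) 0) = Oct 0 u v 0"
    using a(2) c by (simp add: oct_basis_change_def cofactor3_def lincomb3_def)
  moreover have "oct_basis_change a b c \<in> oct_aut"
    using a(1) c by (intro oct_basis_change_aut) simp
  ultimately show ?thesis
    unfolding oct_orbit_def by (metis (mono_tags, lifting) mem_Collect_eq)
qed

lemma offdiagonal_in_orbit:
  assumes v: "v \<noteq> 0" and uv: "dot3 u v = \<gamma>"
  shows "Oct 0 u v 0 \<in> oct_orbit 0 \<gamma>"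
proof (cases "\<gamma> \<noteq> 0 \<or> u = 0")
  case True
  then show ?thesis using offdiagonal_in_orbit_basic assms by blast
next
  case False
  then have u: "u \<noteq> 0" and \<gamma>: "\<gamma> = 0" by auto
  \<comment> \<open>The transvection along such a \<open>w\<close> kills \<open>v\<close> and leaves \<open>u\<close> alone.\<close>
  then obtain w where w: "crossp3 u w = v"
    using exists_crossp3_eq uv by blast
  have "dot3 w v = 0"
    by (simp add: w[symmetric] vec3_coords algebra_simps)
  \<comment> \<open>The swap moves the remaining vector to the lower slot and leaves zero above it,
    which is the basic case.\<close>
  then have "oct_swap (oct_transvection w (Oct 0 u v 0)) = Oct 0 0 (- u) 0"
    by (simp add: oct_swap_def oct_transvection_def w)
  moreover have "Oct 0 0 (- u) 0 \<in> oct_orbit 0 \<gamma>"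
    using u \<gamma> by (intro offdiagonal_in_orbit_basic) (auto simp: dot3_def)
  ultimately show ?thesis
    by (metis oct_orbit_pullback oct_swap_aut oct_transvection_aut)
qed

lemma traceless_in_orbit_lower:
  assumes v: "v \<noteq> 0" and \<gamma>: "a\<^sup>2 + dot3 u v = \<gamma>"
  shows "Oct a u v (- a) \<in> oct_orbit 0 \<gamma>"
proof (cases "a = 0")
  case True
  then show ?thesis using offdiagonal_in_orbit assms by simp
next
  case False
  \<comment> \<open>With this value the transvection along \<open>w\<close> clears both diagonal
    entries.\<close>
  obtain w where w: "dot3 w v = a"
    using exists_dot3_eq[OF v] by blast
  \<comment> \<open>The new lower vector still pairs with \<open>w\<close> to \<open>a\<close>,
    which is nonzero here, so it cannot vanish.\<close>
  have "dot3 w (v - crossp3 u w) = dot3 w v"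
    by (simp add: vec3_coords algebra_simps)
  then have nz: "v - crossp3 u w \<noteq> 0"
    using w False by (auto simp: dot3_def)
  have "dot3 (u + a *s w) (v - crossp3 u w) = dot3 u v + a * dot3 w v"
    by (simp add: vec3_coords algebra_simps)
  then have "Oct 0 (u + a *s w) (v - crossp3 u w) 0 \<in> oct_orbit 0 \<gamma>"
    using w \<gamma> nz by (intro offdiagonal_in_orbit) (simp_all add: power2_eq_square algebra_simps)
  moreover have "oct_transvection w (Oct a u v (- a)) = Oct 0 (u + a *s w) (v - crossp3 u w) 0"
    by (simp add: oct_transvection_def w)
  ultimately show ?thesis
    by (metis oct_orbit_pullback oct_transvection_aut)
qed

lemma traceless_in_orbit_nonzero:
  assumes nz: "u \<noteq> 0 \<or> v \<noteq> 0" and \<gamma>: "a\<^sup>2 + dot3 u v = \<gamma>"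
  shows "Oct a u v (- a) \<in> oct_orbit 0 \<gamma>"
proof (cases "v = 0")
  case False
  then show ?thesis using traceless_in_orbit_lower \<gamma> by blast
next
  case True
  then have "Oct (- a) (- v) (- u) (- (- a)) \<in> oct_orbit 0 \<gamma>"
    using nz \<gamma> by (intro traceless_in_orbit_lower) (auto simp: dot3_def)
  moreover have "oct_swap (Oct a u v (- a)) = Oct (- a) (- v) (- u) (- (- a))"
    by (simp add: oct_swap_def)
  ultimately show ?thesis
    by (metis oct_orbit_pullback oct_swap_aut)
qed

lemma traceless_in_orbit:
  assumes tr: "oct_tr x = 0" and x: "x \<notin> oct_scalars" and \<gamma>: "- oct_norm x = \<gamma>"
  shows "x \<in> oct_orbit 0 \<gamma>"
proof -
  obtain a u v where xe: "x = Oct a u v (- a)"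
    using tr by (cases x) (auto simp: oct_tr_def add_eq_0_iff)
  have \<gamma>': "a\<^sup>2 + dot3 u v = \<gamma>"
    using \<gamma> by (simp add: xe oct_norm_def power2_eq_square add.commute)
  show ?thesis
  proof (cases "u \<noteq> 0 \<or> v \<noteq> 0")
    case True
    then show ?thesis using traceless_in_orbit_nonzero \<gamma>' xe by blast
  next
    case False
    \<comment> \<open>Only a diagonal \<open>x\<close> remains; if \<open>2 * a = 0\<close> its
      entries \<open>a\<close> and \<open>- a\<close> agree and it is scalar.\<close>
    then have "x = a *\<^sub>O 1" if "2 * a = 0"
      using that by (simp add: xe oct_ops vec3_coords eq_neg_iff_add_eq_0[symmetric])
    then have a: "2 * a \<noteq> 0"
      using x by (auto simp: oct_scalars_def)
    \<comment> \<open>The transvection along any nonzero vector gives the diagonal \<open>x\<close>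
      a nonzero upper vector, since \<open>2 * a \<noteq> 0\<close>.\<close>
    let ?w = "vector [1, 0, 0] :: 'a ^ 3"
    have "oct_transvection ?w x = Oct a ((2 * a) *s ?w) 0 (- a)"
      using False by (simp add: xe oct_transvection_def vec3_coords)
    moreover have "Oct a ((2 * a) *s ?w) 0 (- a) \<in> oct_orbit 0 \<gamma>"
      using a \<gamma>' False by (intro traceless_in_orbit_nonzero) (auto simp: vec3_coords)
    ultimately show ?thesis
      by (metis oct_orbit_pullback oct_transvection_aut)
  qed
qed

section \<open>Square roots of a scalar\<close>

text \<open>The representative squares to \<open>\<gamma> *\<^sub>O 1\<close>, and automorphisms fix
  scalars because they fix the unity.\<close>

lemma orbit_square:
  assumes "x \<in> oct_orbit 0 \<gamma>"
  shows "x * x = \<gamma> *\<^sub>O 1"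
proof -
  let ?e = "Oct 0 (vector [\<gamma>, 0, 0]) (vector [1, 0, 0]) 0 :: 'a octonion"
  obtain f where f: "f \<in> oct_aut" "x = f ?e"
    using assms by (auto simp: oct_orbit_def)
  have "?e * ?e = \<gamma> *\<^sub>O 1"
    by (simp add: oct_ops vec3_coords)
  then show ?thesis
    by (metis f oct_aut_one oct_aut_simps(2,3))
qed

lemma oct_square_roots_scalar:
  assumes s: "sqrt_choice s"
  shows "{x. x * x = \<gamma> *\<^sub>O 1} = (\<lambda>\<nu>. \<nu> *\<^sub>O 1) ` pm_sqrt s \<gamma> \<union> oct_orbit 0 \<gamma>"
proof (intro equalityI subsetI)
  fix x :: "'a octonion"
  assume "x \<in> {x. x * x = \<gamma> *\<^sub>O 1}"
  then have x: "x * x = \<gamma> *\<^sub>O 1" by simp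
  show "x \<in> (\<lambda>\<nu>. \<nu> *\<^sub>O 1) ` pm_sqrt s \<gamma> \<union> oct_orbit 0 \<gamma>"
  proof (cases "x \<in> oct_scalars")
    case True
    then obtain \<nu> where "x = \<nu> *\<^sub>O 1" by (auto simp: oct_scalars_def)
    then show ?thesis
      using x by (auto simp: oct_scale_one_square oct_scale_one_inject simp flip: pm_sqrt_eq[OF s])
  next
    case False
    have eq: "oct_tr x *\<^sub>O x = (\<gamma> + oct_norm x) *\<^sub>O 1"
      using oct_square[of x] x by (simp add: oct_scale_add_left algebra_simps)
    \<comment> \<open>Dividing \<open>eq\<close> by a nonzero trace would make \<open>x\<close> a
      scalar.\<close>
    have tr: "oct_tr x = 0"
    proof (rule ccontr)
      assume "oct_tr x \<noteq> 0"
      then have "x = (1 / oct_tr x) *\<^sub>O oct_tr x *\<^sub>O x"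
        by (simp add: oct_scale_scale oct_scale_one_left)
      with False show False by (auto simp: eq oct_scale_scale oct_scalars_def)
    qed
    then have "\<gamma> + oct_norm x = 0"
      using eq by (metis oct_scale_zero_left oct_scale_one_inject)
    then have "x \<in> oct_orbit 0 \<gamma>"
      using tr False by (intro traceless_in_orbit) (simp_all add: add_eq_0_iff2)
    then show ?thesis ..
  qed
next
  fix x :: "'a octonion"
  assume "x \<in> (\<lambda>\<nu>. \<nu> *\<^sub>O 1) ` pm_sqrt s \<gamma> \<union> oct_orbit 0 \<gamma>"
  then show "x \<in> {x. x * x = \<gamma> *\<^sub>O 1}"
    by (auto simp: oct_scale_one_square orbit_square simp flip: pm_sqrt_eq[OF s])
qed

theorem proposition4p2:
  fixes c :: "'a::field octonion" and X :: "'a octonion set" and s :: "'a \<Rightarrow> 'a"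
  assumes s: "sqrt_choice s"
    and X: "X = {x. x * x = c}"
  shows
    "(\<forall>\<gamma>. c = \<gamma> *\<^sub>O 1 \<longrightarrow> X = (\<lambda>\<nu>. \<nu> *\<^sub>O 1) ` pm_sqrt s \<gamma> \<union> oct_orbit 0 \<gamma>) \<and>
     (c \<notin> oct_scalars \<and> CHAR('a) \<noteq> 2 \<longrightarrow>
        (oct_norm c \<in> squares \<longrightarrow>
          (let \<alpha> = oct_tr c + 2 * s (oct_norm c);
               \<beta> = oct_tr c - 2 * s (oct_norm c);
               p = (1 / s \<alpha>) *\<^sub>O (c + s (oct_norm c) *\<^sub>O 1);
               q = (1 / s \<beta>) *\<^sub>O (c - s (oct_norm c) *\<^sub>O 1)
           in (\<alpha> \<in> nonzero_squares \<and> \<beta> \<in> nonzero_squares \<longrightarrow> X = {p, - p, q, - q}) \<and>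
              (\<alpha> \<in> nonzero_squares \<and> \<beta> \<notin> nonzero_squares \<longrightarrow> X = {p, - p}) \<and>
              (\<alpha> \<notin> nonzero_squares \<and> \<beta> \<in> nonzero_squares \<longrightarrow> X = {q, - q}) \<and>
              (\<alpha> \<notin> nonzero_squares \<and> \<beta> \<notin> nonzero_squares \<longrightarrow> X = {}))) \<and>
        (oct_norm c \<notin> squares \<longrightarrow> X = {})) \<and>
     (c \<notin> oct_scalars \<and> CHAR('a) = 2 \<longrightarrow>
        (oct_tr c \<noteq> 0 \<longrightarrow>
          X = (if oct_tr c \<in> squares \<and> oct_norm c \<in> squares
               then {(1 / s (oct_tr c)) *\<^sub>O (c + s (oct_norm c) *\<^sub>O 1)}
               else {})) \<and>
        (oct_tr c = 0 \<longrightarrow> X = {}))"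
proof (intro conjI allI impI; (elim conjE)?)
  show "X = (\<lambda>\<nu>. \<nu> *\<^sub>O 1) ` pm_sqrt s \<gamma> \<union> oct_orbit 0 \<gamma>" if "c = \<gamma> *\<^sub>O 1" for \<gamma>
    using oct_square_roots_scalar[OF s] that X by simp
next
  assume "c \<notin> oct_scalars"
  note roots = oct_square_roots_nonscalar[OF s this]
  show "X = {}" if "oct_norm c \<notin> squares"
    using that by (simp add: X roots pm_sqrt_def)
  show "let \<alpha> = oct_tr c + 2 * s (oct_norm c);
            \<beta> = oct_tr c - 2 * s (oct_norm c);
            p = (1 / s \<alpha>) *\<^sub>O (c + s (oct_norm c) *\<^sub>O 1);
            q = (1 / s \<beta>) *\<^sub>O (c - s (oct_norm c) *\<^sub>O 1)
        in (\<alpha> \<in> nonzero_squares \<and> \<beta> \<in> nonzero_squares \<longrightarrow> X = {p, - p, q, - q}) \<and>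
           (\<alpha> \<in> nonzero_squares \<and> \<beta> \<notin> nonzero_squares \<longrightarrow> X = {p, - p}) \<and>
           (\<alpha> \<notin> nonzero_squares \<and> \<beta> \<in> nonzero_squares \<longrightarrow> X = {q, - q}) \<and>
           (\<alpha> \<notin> nonzero_squares \<and> \<beta> \<notin> nonzero_squares \<longrightarrow> X = {})"
    if "oct_norm c \<in> squares"
    \<comment> \<open>The two members \<nu> of \<open>pm_sqrt s (oct_norm c)\<close> turn
      \<open>oct_tr c + 2 * \<nu>\<close> into \<alpha> and \<beta>.\<close>
    using that by (auto simp: X roots pm_sqrt_def Let_def oct_scale_minus_left)
next
  assume c: "c \<notin> oct_scalars" and char: "CHAR('a) = 2"
  note roots = oct_square_roots_nonscalar[OF s c]
  \<comment> \<open>In characteristic two all signs coincide and \<open>oct_tr c + 2 * \<nu>\<close>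
    is \<open>oct_tr c\<close>, so the union collapses to at most one solution.\<close>
  have two: "(2 :: 'a) = 0"
    using of_nat_CHAR[where 'a = 'a] char by simp
  then have neg: "- k = k" for k :: 'a
    by (metis mult_2 mult_zero_left neg_eq_iff_add_eq_0)
  then have oct_neg: "- x = x" for x :: "'a octonion"
    by (cases x) (simp add: oct_ops vec3_coords)
  have nz: "k \<in> nonzero_squares \<longleftrightarrow> k \<in> squares \<and> k \<noteq> 0" for k :: 'a
    by (auto simp: nonzero_squares_def squares_def)
  show "X = (if oct_tr c \<in> squares \<and> oct_norm c \<in> squares
             then {(1 / s (oct_tr c)) *\<^sub>O (c + s (oct_norm c) *\<^sub>O 1)} else {})"
    if "oct_tr c \<noteq> 0"
    using that by (simp add: X roots pm_sqrt_def Let_def neg oct_neg two nz)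
  show "X = {}" if "oct_tr c = 0"
    using that by (simp add: X roots pm_sqrt_def Let_def two nz)
qed

end
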